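(* Consider the following problem (min-RIPDD with at most one data hand-over per agent). An instance consists of a connected undirected graph $G$ in which every edge $e$ has a positive integer length $w(e)$, two vertices $s\neq t$, a fixed $s$–$t$ path $\mathcal{P}$ in $G$ of total length $W$, and $k\ge 1$ agents located initially at vertices $q_1,\dots,q_k$ of $G$. Following the paper's convention, every edge of length $w(e)$ is regarded as subdivided into $w(e)$ edges of length $1$, so that "points" of $G$ (and of $\mathcal{P}$) are vertices of this subdivided graph, and $d(x,y)$ denotes the shortest-path distance between points $x,y$. A feasible solution assigns to each agent $i$ a walk $p_i$ in (the subdivided) $G$ starting at $q_i$ (possibly of length $0$), such that the union of the walks contains all of $\mathcal{P}$ and each walk $p_i$ contains (carries data along) at most one connected subpath of $\mathcal{P}$; concretely, there are points $s=s^*_1,s^*_2,\dots,s^*_l$ in order along $\mathcal{P}$ and distinct agents $q^*_1,\dots,q^*_l$, where agent $q^*_j$ travels to $s^*_j$ and then carries the data along $\mathcal{P}$ from $s^*_j$ to $s^*_{j+1}$ (with $s^*_{l+1}=t$). The cost of a solution is the maximum length of a walk $p_i$ (the common energy budget needed), and $R^*$ denotes the minimum cost over all feasible solutions. Algorithm Matching: for every integer $\beta$ with $W/k\le\beta\le W$, do the following (Matching$_\beta$). Cut $\mathcal{P}$, starting from $s$, into consecutive pieces, the first of length $W\bmod\beta$ if this is positive and all others of length exactly $\beta$; let $s_1=s,s_2,\dots,s_{m}$ be the starting points of the pieces (so $m=\lceil W/\beta\rceil\le k$) and $b_j$ the length of the piece starting at $s_j$. Form the complete bipartite graph between the agents $\{q_1,\dots,q_k\}$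 and the selection points $\{s_1,\dots,s_m\}$, where the edge $q_is_j$ has weight $d(q_i,s_j)$, and compute a matching $M_\beta$ covering all selection points that minimizes the maximum weight of a matching edge. The agent matched to $s_j$ walks to $s_j$ along a shortest path and then carries the data along the piece starting at $s_j$; the value of Matching$_\beta$ is $\max_j\big(d(q_{\sigma(j)},s_j)+b_j\big)$, where $q_{\sigma(j)}$ is the agent matched to $s_j$. Matching outputs the solution of minimum value among all Matching$_\beta$. Claim: Matching is a $3$-approximation algorithm for this problem, i.e. for every instance it returns a feasible solution whose cost $R$ satisfies $R\le 3R^*$.
   Context: In the data delivery setting, $k$ mobile agents move along edges of the graph, consuming energy equal to the length traversed; all agents have the same initial energy budget, data must be picked up at $s$ and delivered to $t$, and may only be carried along the fixed path $\mathcal{P}$, being handed from agent to agent when they meet. Each agent may receive the data at most once. The min-RIPDD problem asks for the minimum common energy budget for which delivery along $\mathcal{P}$ is possible. *)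

theory Defs
  imports "Graph_Theory.Digraph_Component" "Graph_Theory.Shortest_Path"
begin

text \<open>
  Undirected simple graphs are represented, as in the library, by finite symmetric loop-free
  digraphs (locale \<open>pair_graph\<close>). The lengths of the two arcs of an edge have to agree.
\<close>

text \<open>
  The point at distance \<open>i\<close> from \<open>u\<close> on the edge \<open>{u, v}\<close> is also the point at distance
  \<open>w (u, v) - i\<close> from \<open>v\<close>. Recording an inner point by the \<^emph>\<open>set\<close> of both descriptions makes
  it independent of the direction in which the edge is read.
\<close>

datatype 'a point = Vertex 'a | Inner "('a \<times> nat) set"

definition edge_point :: "('a \<times> 'a \<Rightarrow> nat) \<Rightarrow> 'a \<Rightarrow> 'a \<Rightarrow> nat \<Rightarrow> 'a point" where
  "edge_point w u v i =
    (if i = 0 then Vertex u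
     else if i = w (u, v) then Vertex v
     else Inner {(u, i), (v, w (u, v) - i)})"

definition subdivide_arc :: "('a \<times> 'a \<Rightarrow> nat) \<Rightarrow> 'a \<times> 'a \<Rightarrow> ('a point \<times> 'a point) awalk" where
  "subdivide_arc w = (\<lambda>(u, v).
     map (\<lambda>i. (edge_point w u v i, edge_point w u v (Suc i))) [0..<w (u, v)])"

definition subdivide_walk :: "('a \<times> 'a \<Rightarrow> nat) \<Rightarrow> ('a \<times> 'a) awalk \<Rightarrow> ('a point \<times> 'a point) awalk" where
  "subdivide_walk w p = concat (map (subdivide_arc w) p)"

definition subdivide :: "'a pair_pre_digraph \<Rightarrow> ('a \<times> 'a \<Rightarrow> nat) \<Rightarrow> 'a point pair_pre_digraph" where
  "subdivide G w =
    \<lparr> pverts = Vertex ` pverts G \<union> {edge_point w u v i | u v i. (u, v) \<in> parcs G \<and> i \<le> w (u, v)},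
      parcs = (\<Union>e \<in> parcs G. set (subdivide_arc w e)) \<rparr>"

definition gdist :: "('a, 'b) pre_digraph \<Rightarrow> 'a \<Rightarrow> 'a \<Rightarrow> nat" where
  "gdist H x y = (LEAST n. \<exists>p. pre_digraph.awalk H x p y \<and> length p = n)"

text \<open>On connected points this is the library's shortest-path distance for unit arc costs.\<close>

lemma (in wf_digraph) gdist_eq_mu:
  assumes "awalk x p y"
  shows "\<mu> (\<lambda>_. 1) x y = ereal (real (gdist G x y))"
proof -
  have cost: "awalk_cost (\<lambda>_. 1) r = real (length r)" for r
    by (induct r) auto
  have "\<exists>n r. awalk x r y \<and> length r = n"
    using assms by blast
  then obtain r where r: "awalk x r y" "length r = gdist G x y"
    unfolding gdist_def using LeastI_ex[of "\<lambda>n. \<exists>r. awalk x r y \<and> length r = n"] by blast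
  have "gdist G x y \<le> length r'" if "awalk x r' y" for r'
    unfolding gdist_def by (rule Least_le) (use that in blast)
  then show ?thesis
    unfolding \<mu>_def cost using r by (intro antisym INF_greatest INF_lower2[of r]) auto
qed

locale ripdd_instance = pair_graph G for G :: "'a pair_pre_digraph" +
  fixes w :: "'a \<times> 'a \<Rightarrow> nat"
    and s t :: 'a
    and P :: "('a \<times> 'a) awalk"
    and k :: nat
    and q :: "nat \<Rightarrow> 'a"
  assumes connected_graph: "connected (with_proj G)"
    and length_pos: "\<And>e. e \<in> parcs G \<Longrightarrow> 0 < w e"
    and length_sym: "\<And>u v. (u, v) \<in> parcs G \<Longrightarrow> w (u, v) = w (v, u)"
    and source_neq_target: "s \<noteq> t"
    and path: "apath s P t"
    and agents_pos: "1 \<le> k"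
    and agents: "\<And>i. i < k \<Longrightarrow> q i \<in> pverts G"
begin

text \<open>The agents are indexed by \<open>0, \<dots>, k - 1\<close>.\<close>

definition W :: nat where
  "W = sum_list (map w P)"

definition walk :: "'a point \<Rightarrow> ('a point \<times> 'a point) awalk \<Rightarrow> 'a point \<Rightarrow> bool" where
  "walk = pre_digraph.awalk (with_proj (subdivide G w))"

definition d :: "'a point \<Rightarrow> 'a point \<Rightarrow> nat" where
  "d = gdist (with_proj (subdivide G w))"

text \<open>Points of the path are addressed by their distance from \<open>s\<close> along the path.\<close>

definition path_point :: "nat \<Rightarrow> 'a point" where
  "path_point a =
     pre_digraph.awalk_verts (with_proj (subdivide G w)) (Vertex s) (subdivide_walk w P) ! a"

definition segment :: "nat \<Rightarrow> nat \<Rightarrow> ('a point \<times> 'a point) awalk" where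
  "segment a b = take (b - a) (drop a (subdivide_walk w P))"

text \<open>
  The data is carried in \<open>l\<close> stages; in stage \<open>j\<close> agent \<open>c j\<close> walks to the point at position
  \<open>a j\<close> and then carries the data to the one at position \<open>a (Suc j)\<close>. What an agent does after
  passing on the data, and what an agent does that never gets it, is not restricted.
\<close>

definition feasible :: "(nat \<Rightarrow> ('a point \<times> 'a point) awalk) \<Rightarrow> bool" where
  "feasible p \<longleftrightarrow>
    (\<forall>i<k. \<exists>y. walk (Vertex (q i)) (p i) y) \<and>
    (\<exists>l a c. a 0 = 0 \<and> a l = W \<and> (\<forall>j<l. a j \<le> a (Suc j)) \<and>
       inj_on c {..<l} \<and> c ` {..<l} \<subseteq> {..<k} \<and>
       (\<forall>j<l. \<exists>approach rest.
          walk (Vertex (q (c j))) approach (path_point (a j)) \<and>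
          p (c j) = approach @ segment (a j) (a (Suc j)) @ rest))"

definition cost :: "(nat \<Rightarrow> ('a point \<times> 'a point) awalk) \<Rightarrow> nat" where
  "cost p = Max ((\<lambda>i. length (p i)) ` {..<k})"

definition opt :: nat where
  "opt = (LEAST r. \<exists>p. feasible p \<and> cost p = r)"

definition admissible :: "nat \<Rightarrow> bool" where
  "admissible \<beta> \<longleftrightarrow> real W / real k \<le> real \<beta> \<and> \<beta> \<le> W"

text \<open>Pieces and selection points are indexed by \<open>0, \<dots>, num_pieces \<beta> - 1\<close>.\<close>

definition num_pieces :: "nat \<Rightarrow> nat" where
  "num_pieces \<beta> = nat \<lceil>real W / real \<beta>\<rceil>"

definition piece_length :: "nat \<Rightarrow> nat \<Rightarrow> nat" where
  "piece_length \<beta> j = (if j = 0 \<and> W mod \<beta> > 0 then W mod \<beta> else \<beta>)"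

definition piece_start :: "nat \<Rightarrow> nat \<Rightarrow> nat" where
  "piece_start \<beta> j = (\<Sum>i<j. piece_length \<beta> i)"

definition selection_point :: "nat \<Rightarrow> nat \<Rightarrow> 'a point" where
  "selection_point \<beta> j = path_point (piece_start \<beta> j)"

text \<open>
  A matching covering all selection points is given by the injective map \<open>\<sigma>\<close> that sends each
  (index of a) selection point to its partner.
\<close>

definition covering_matching :: "nat \<Rightarrow> (nat \<Rightarrow> nat) \<Rightarrow> bool" where
  "covering_matching \<beta> \<sigma> \<longleftrightarrow>
    inj_on \<sigma> {..<num_pieces \<beta>} \<and> \<sigma> ` {..<num_pieces \<beta>} \<subseteq> {..<k}"

definition bottleneck :: "nat \<Rightarrow> (nat \<Rightarrow> nat) \<Rightarrow> nat" where
  "bottleneck \<beta> \<sigma> = Max ((\<lambda>j. d (Vertex (q (\<sigma> j))) (selection_point \<beta> j)) ` {..<num_pieces \<beta>})"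

definition matching_value :: "nat \<Rightarrow> (nat \<Rightarrow> nat) \<Rightarrow> nat" where
  "matching_value \<beta> \<sigma> =
     Max ((\<lambda>j. d (Vertex (q (\<sigma> j))) (selection_point \<beta> j) + piece_length \<beta> j) ` {..<num_pieces \<beta>})"

definition matching_solution ::
    "nat \<Rightarrow> (nat \<Rightarrow> nat) \<Rightarrow> (nat \<Rightarrow> ('a point \<times> 'a point) awalk) \<Rightarrow> bool" where
  "matching_solution \<beta> \<sigma> p \<longleftrightarrow>
    (\<forall>j<num_pieces \<beta>. \<exists>r.
       walk (Vertex (q (\<sigma> j))) r (selection_point \<beta> j) \<and>
       length r = d (Vertex (q (\<sigma> j))) (selection_point \<beta> j) \<and>
       p (\<sigma> j) = r @ segment (piece_start \<beta> j) (piece_start \<beta> j + piece_length \<beta> j)) \<and>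
    (\<forall>i<k. i \<notin> \<sigma> ` {..<num_pieces \<beta>} \<longrightarrow> p i = [])"

text \<open>
  The algorithm may break ties arbitrarily: \<open>M \<beta>\<close> is the bottleneck matching it happens to
  compute for \<open>\<beta>\<close>, and \<open>\<beta>\<close> is any parameter for which the value of \<open>M \<beta>\<close> is least.
\<close>

definition matching_output :: "(nat \<Rightarrow> ('a point \<times> 'a point) awalk) \<Rightarrow> bool" where
  "matching_output p \<longleftrightarrow>
    (\<exists>M \<beta>.
       (\<forall>\<gamma>. admissible \<gamma> \<longrightarrow> is_arg_min (bottleneck \<gamma>) (covering_matching \<gamma>) (M \<gamma>)) \<and>
       is_arg_min (\<lambda>\<gamma>. matching_value \<gamma> (M \<gamma>)) admissible \<beta> \<and>
       matching_solution \<beta> (M \<beta>) p)"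

end

end

theory Submission
  imports Defs
begin

text \<open>
  Let an optimal solution have cost \<open>R\<close>, and let \<open>\<beta> \<le> R\<close> be the length of the longest subpath it
  assigns to an agent. Then \<open>\<beta>\<close> is admissible. All selection points except the first are spaced
  by exactly \<open>\<beta>\<close>, so they lie in different optimal subpaths, the \<open>i\<close>-th one in the subpath with
  index \<open>seg i \<ge> i - 1\<close>. Assigning the \<open>i\<close>-th selection point to the agent of the subpath
  \<open>max i (seg i)\<close> is injective and moves a point at most to the beginning of the next subpath.
  The resulting matching has bottleneck at most \<open>R + \<beta>\<close>, so the bottleneck matching for \<open>\<beta>\<close> has
  value at most \<open>R + 2 \<beta> \<le> 3 R\<close>.
\<close>

section \<open>Assigning equidistant points to intervals\<close>

text \<open>Induction on \<open>l\<close>: either \<open>x\<close> is already reached by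
  \<open>a l\<close>, or it lies in the last interval. Intervals are open on the left, so a
  breakpoint belongs to the interval ending there; this strictness later separates points at
  distance exactly \<open>b\<close>.\<close>

lemma exists_interval_containing:
  fixes a :: "nat \<Rightarrow> nat"
  assumes "a 0 < x" "x \<le> a l"
  shows "\<exists>j<l. a j < x \<and> x \<le> a (Suc j)"
  using assms
proof (induction l)
  case (Suc l)
  then show ?case
    by (cases "x \<le> a l") (auto intro: less_SucI)
qed simp

lemma mono_chain:
  fixes a :: "nat \<Rightarrow> nat"
  assumes "\<And>j. j < l \<Longrightarrow> a j \<le> a (Suc j)" "i \<le> j" "j \<le> l"
  shows "a i \<le> a j"
  using assms(2,3)
proof (induction j rule: dec_induct)
  case (step n)
  then show ?case
    using assms(1)[of n] by simp
qed simp

text \<open>The \<open>a j\<close> are the hand-over positions of a feasible solution, the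
  \<open>x i\<close> the selection points. The spacing \<open>b\<close> is demanded only from index
  1 on, because the first piece may be shorter; points 0 and 1 may thus compete for interval 0, and
  shifting some points to the next interval resolves this.\<close>

lemma injective_interval_assignment:
  fixes a x :: "nat \<Rightarrow> nat"
  assumes a0: "a 0 = 0"
    and mono: "\<And>j. j < l \<Longrightarrow> a j \<le> a (Suc j)"
    and short: "\<And>j. j < l \<Longrightarrow> a (Suc j) - a j \<le> b"
    and x0: "x 0 = 0"
    and x_range: "\<And>i. 0 < i \<Longrightarrow> i < m \<Longrightarrow> 0 < x i \<and> x i \<le> a l"
    and x_step: "\<And>i. 0 < i \<Longrightarrow> Suc i < m \<Longrightarrow> x (Suc i) = x i + b"
    and "m \<le> l"
  shows "\<exists>f. inj_on f {..<m} \<and> f ` {..<m} \<subseteq> {..<l} \<and>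
           (\<forall>i<m. a (f i) \<le> x i \<and> x i \<le> a (Suc (f i)) \<or> x i \<le> a (f i) \<and> a (f i) \<le> x i + b)"
proof -
  have "\<exists>j. 0 < i \<longrightarrow> i < m \<longrightarrow> j < l \<and> a j < x i \<and> x i \<le> a (Suc j)" for i
    using exists_interval_containing[of a "x i" l] x_range[of i] a0 by auto
  then obtain seg where
    seg: "\<And>i. 0 < i \<Longrightarrow> i < m \<Longrightarrow> seg i < l \<and> a (seg i) < x i \<and> x i \<le> a (Suc (seg i))"
    by metis
  have seg_less: "seg i < seg (Suc i)" if "0 < i" "Suc i < m" for i
  \<comment> \<open>Otherwise \<open>x (Suc i) \<le> a (Suc (seg i)) \<le> a (seg i) + b < x i +
    b\<close>, contradicting the spacing.\<close>
  proof (rule ccontr)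
    assume "\<not> seg i < seg (Suc i)"
    then have "a (Suc (seg (Suc i))) \<le> a (Suc (seg i))"
      using seg[of i] that by (intro mono_chain[where a = a and l = l, OF mono]) auto
    moreover have "a (Suc (seg i)) \<le> a (seg i) + b"
      using short[of "seg i"] seg[of i] that by simp
    ultimately show False
      using seg[of i] seg[of "Suc i"] x_step[of i] that by simp
  qed
  have seg_ge: "i \<le> Suc (seg i)" if "0 < i" "i < m" for i
    using that
  proof (induction i)
    case (Suc i)
    then show ?case
      using seg_less[of i] by (cases "i = 0") auto
  qed simp
  \<comment> \<open>Point 0 lies in no left-open interval, so \<open>seg 0\<close> is arbitrary and
    interval 0 is set by hand. Both arguments of \<open>max\<close> increase strictly with
    \<open>i\<close>, hence so does \<open>f\<close>.\<close>
  define f where "f i = (if i = 0 then 0 else max i (seg i))" for i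
  have f_less_Suc: "f i < f (Suc i)" if "Suc i < m" for i
    using seg_less[of i] that by (auto simp: f_def)
  have "f i < f j" if "i < j" "j < m" for i j
    using that
  proof (induction j)
    case (Suc j)
    then show ?case
      using f_less_Suc[of j] by (cases "i = j") auto
  qed simp
  then have "inj_on f {..<m}"
    by (metis (no_types, lifting) inj_onI lessThan_iff linorder_neqE_nat less_irrefl)
  moreover have "f ` {..<m} \<subseteq> {..<l}"
    using seg \<open>m \<le> l\<close> by (force simp: f_def)
  moreover have
    "a (f i) \<le> x i \<and> x i \<le> a (Suc (f i)) \<or> x i \<le> a (f i) \<and> a (f i) \<le> x i + b" if i: "i < m" for i
  proof -
    \<comment> \<open>As \<open>i \<le> Suc (seg i)\<close>, the maximum moves a point by at most
      one interval.\<close>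
    consider "i = 0" | "0 < i" "f i = seg i" | "0 < i" "f i = Suc (seg i)"
      using seg_ge[of i] i unfolding f_def max_def
      by (metis bot_nat_0.not_eq_extremum le_SucE)
    then show ?thesis
    proof cases
      case 3
      then show ?thesis
        using seg[of i] short[of "seg i"] i by auto
    qed (use seg[of i] i x0 a0 in \<open>auto simp: f_def\<close>)
  qed
  ultimately show ?thesis
    by blast
qed

section \<open>Walks and distances\<close>

context wf_digraph
begin

lemma awalk_take_drop:
  assumes "awalk u p v" "n \<le> length p"
  shows "awalk u (take n p) (awalk_verts u p ! n)" "awalk (awalk_verts u p ! n) (drop n p) v"
proof -
  have "awalk u (take n p) (awalk_verts u p ! n) \<and> awalk (awalk_verts u p ! n) (drop n p) v"
    using assms
  proof (induction p arbitrary: u n)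
    case (Cons e p)
    then show ?case
      by (cases n) (auto simp: awalk_Cons_iff awalk_Nil_iff dest: awalk_hd_in_verts)
  qed (auto simp: awalk_Nil_iff)
  then show "awalk u (take n p) (awalk_verts u p ! n)" "awalk (awalk_verts u p ! n) (drop n p) v"
    by auto
qed

lemma awalk_slice:
  assumes "awalk u p v" "i \<le> j" "j \<le> length p"
  shows "awalk (awalk_verts u p ! i) (take (j - i) (drop i p)) (awalk_verts u p ! j)"
proof -
  \<comment> \<open>The tail is cut off first, so that index \<open>i\<close> keeps its meaning in
    the remaining prefix.\<close>
  have "awalk (awalk_verts u (take j p) ! i) (drop i (take j p)) (awalk_verts u p ! j)"
    using assms by (intro awalk_take_drop[of _ "take j p"] awalk_take_drop) auto
  moreover have "awalk_verts u (take j p) ! i = awalk_verts u p ! i"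
    using assms awalk_verts_take_conv[of u p v j] by (simp add: awalk_def)
  ultimately show ?thesis
    by (simp add: drop_take)
qed

lemma gdist_le:
  assumes "awalk x p y"
  shows "gdist G x y \<le> length p"
  unfolding gdist_def by (rule Least_le) (use assms in blast)

lemma exists_shortest_awalk:
  assumes "awalk x p y"
  shows "\<exists>r. awalk x r y \<and> length r = gdist G x y"
  unfolding gdist_def by (rule LeastI_ex) (use assms in blast)

end

text \<open>Symmetry supplies some arc back for each arc. This lets an agent move backwards along
  the path at the same expense.\<close>

lemma (in sym_digraph) exists_reverse_awalk:
  assumes "awalk u p v"
  shows "\<exists>r. awalk v r u \<and> length r = length p"
  using assms
proof (induction p arbitrary: u)
  case (Cons e p)
  then obtain r where r: "awalk v r (head G e)" "length r = length p"
    by (auto simp: awalk_Cons_iff)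
  from Cons.prems have "u \<rightarrow>\<^bsub>G\<^esub> head G e"
    by (auto simp: awalk_Cons_iff in_arcs_imp_in_arcs_ends)
  then have "head G e \<rightarrow>\<^bsub>G\<^esub> u"
    by (simp add: arcs_ends_symmetric sym_arcs)
  then obtain e' where "e' \<in> arcs G" "tail G e' = head G e" "head G e' = u"
    by (auto simp: arcs_ends_conv)
  then have "awalk (head G e) [e'] u"
    using arc_implies_awalk by fastforce
  with r show ?case
    by (intro exI[of _ "r @ [e']"]) auto
qed (auto simp: awalk_Nil_iff)

section \<open>The subdivided graph\<close>

context ripdd_instance
begin

text \<open>The set in \<open>Inner\<close> contains both descriptions of the point, so exchanging
  the ends only reorders it; positive length keeps the two end cases apart.\<close>

lemma edge_point_swap:
  assumes "(u, v) \<in> parcs G" "i \<le> w (u, v)"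
  shows "edge_point w v u (w (u, v) - i) = edge_point w u v i"
  using assms length_pos[of "(u, v)"] length_sym[of u v] by (auto simp: edge_point_def)

lemma edge_point_ends:
  assumes "(u, v) \<in> parcs G"
  shows "edge_point w u v 0 = Vertex u" "edge_point w u v (w (u, v)) = Vertex v"
  using length_pos[OF assms] by (auto simp: edge_point_def)

lemma edge_point_in_subdivide:
  assumes "(u, v) \<in> parcs G" "i \<le> w (u, v)"
  shows "edge_point w u v i \<in> pverts (subdivide G w)"
  using assms by (auto simp: subdivide_def)

lemma parcs_subdivide_iff:
  "(x, y) \<in> parcs (subdivide G w) \<longleftrightarrow>
    (\<exists>u v i. (u, v) \<in> parcs G \<and> i < w (u, v) \<and> x = edge_point w u v i \<and> y = edge_point w u v (Suc i))"
  by (force simp: subdivide_def subdivide_arc_def)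

lemma sym_digraph_subdivide: "sym_digraph (with_proj (subdivide G w))"
proof
  fix e assume "e \<in> arcs (with_proj (subdivide G w))"
  then have e: "(fst e, snd e) \<in> parcs (subdivide G w)"
    by simp
  show "tail (with_proj (subdivide G w)) e \<in> verts (with_proj (subdivide G w))"
    using e unfolding parcs_subdivide_iff by (auto intro!: edge_point_in_subdivide)
  show "head (with_proj (subdivide G w)) e \<in> verts (with_proj (subdivide G w))"
    using e unfolding parcs_subdivide_iff by (auto intro!: edge_point_in_subdivide)
next
  show "symmetric (with_proj (subdivide G w))"
    unfolding symmetric_def
  proof (rule symI)
    fix x y assume "(x, y) \<in> arcs_ends (with_proj (subdivide G w))"
    then obtain u v i where *: "(u, v) \<in> parcs G" "i < w (u, v)"
      "x = edge_point w u v i" "y = edge_point w u v (Suc i)"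
      by (auto simp: parcs_subdivide_iff)
    \<comment> \<open>The position of \<open>y\<close> measured from \<open>v\<close>; read from
      there, the unit arc runs from \<open>Suc j\<close> down to \<open>j\<close>.\<close>
    define j where "j = w (u, v) - Suc i"
    have "(v, u) \<in> parcs G"
      using * by (metis arcs_symmetric)
    moreover have "j < w (v, u)" "y = edge_point w v u j" "x = edge_point w v u (Suc j)"
      using * length_sym[of u v] edge_point_swap[of u v i] edge_point_swap[of u v "Suc i"]
      by (auto simp: j_def Suc_diff_Suc)
    ultimately show "(y, x) \<in> arcs_ends (with_proj (subdivide G w))"
      by (auto simp: parcs_subdivide_iff)
  qed
qed

interpretation S: sym_digraph "with_proj (subdivide G w)"
  by (rule sym_digraph_subdivide)

section \<open>Walks in the subdivided graph and along the path\<close>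

lemma walk_append: "walk x p y \<Longrightarrow> walk y r z \<Longrightarrow> walk x (p @ r) z"
  unfolding walk_def by (rule S.awalk_appendI)

lemma walk_Nil: "x \<in> pverts (subdivide G w) \<Longrightarrow> walk x [] x"
  by (simp add: walk_def S.awalk_Nil_iff)

lemma walk_subdivide_arc:
  assumes "(u, v) \<in> parcs G"
  shows "walk (Vertex u) (subdivide_arc w (u, v)) (Vertex v)"
proof -
  let ?step = "\<lambda>i. (edge_point w u v i, edge_point w u v (Suc i))"
  have "walk (Vertex u) (map ?step [0..<n]) (edge_point w u v n)" if "n \<le> w (u, v)" for n
    using that
  proof (induction n)
    case 0
    show ?case
      using edge_point_in_subdivide[OF assms, of 0] edge_point_ends[OF assms] by (simp add: walk_Nil)
  next
    case (Suc n)
    then have "?step n \<in> parcs (subdivide G w)"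
      using assms unfolding parcs_subdivide_iff by (blast intro: Suc_le_lessD)
    then have "walk (edge_point w u v n) [?step n] (edge_point w u v (Suc n))"
      using S.arc_implies_awalk[of "?step n"] by (simp add: walk_def)
    with Suc show ?case
      by (auto intro: walk_append)
  qed
  from this[of "w (u, v)"] show ?thesis
    using edge_point_ends[OF assms] by (simp add: subdivide_arc_def)
qed

lemma walk_subdivide_walk:
  assumes "awalk u p v"
  shows "walk (Vertex u) (subdivide_walk w p) (Vertex v)"
  using assms
proof (induction p arbitrary: u)
  case Nil
  then show ?case
    by (auto simp: subdivide_walk_def subdivide_def awalk_Nil_iff intro!: walk_Nil)
next
  case (Cons e p)
  then have "e = (u, snd e)" "e \<in> parcs G" "walk (Vertex (snd e)) (subdivide_walk w p) (Vertex v)"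
    by (auto simp: awalk_Cons_iff)
  then have "walk (Vertex u) (subdivide_arc w e) (Vertex (snd e))"
    using walk_subdivide_arc[of u "snd e"] by simp
  then show ?case
    using \<open>walk (Vertex (snd e)) (subdivide_walk w p) (Vertex v)\<close>
    by (simp add: subdivide_walk_def walk_append)
qed

text \<open>An edge contributes as many unit arcs as its length. Hence every position up to
  \<open>W\<close> is a valid index for \<open>path_point\<close> and
  \<open>segment\<close>.\<close>

lemma length_subdivide_path: "length (subdivide_walk w P) = W"
proof -
  have "length (subdivide_walk w p) = sum_list (map w p)" for p
    by (induction p) (auto simp: subdivide_walk_def subdivide_arc_def split: prod.splits)
  then show ?thesis
    by (simp add: W_def)
qed

lemma walk_path: "walk (Vertex s) (subdivide_walk w P) (Vertex t)"
  using path walk_subdivide_walk by (simp add: apath_def)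

lemma W_pos: "0 < W"
proof (cases P)
  case Nil
  then show ?thesis
    using path source_neq_target by (simp add: apath_Nil_iff)
next
  case (Cons e p)
  then have "e \<in> parcs G"
    using path by (simp add: apath_Cons_iff)
  then show ?thesis
    using length_pos[of e] unfolding W_def by (simp add: Cons)
qed

lemma length_segment:
  assumes "x \<le> y" "y \<le> W"
  shows "length (segment x y) = y - x"
  using assms by (simp add: segment_def length_subdivide_path)

lemma walk_segment:
  assumes "x \<le> y" "y \<le> W"
  shows "walk (path_point x) (segment x y) (path_point y)"
  using S.awalk_slice[of "Vertex s" "subdivide_walk w P" "Vertex t" x y] walk_path assms
  by (simp add: walk_def path_point_def segment_def length_subdivide_path)

text \<open>Go to \<open>s\<close>, then follow the path. This makes the minimum in \<open>d\<close>
  range over a nonempty set.\<close>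

lemma exists_walk_to_path_point:
  assumes "i < k" "x \<le> W"
  shows "\<exists>r. walk (Vertex (q i)) r (path_point x)"
proof -
  have "s \<in> pverts G"
    using path by (auto simp: apath_def dest: awalk_hd_in_verts)
  \<comment> \<open>\<open>connected\<close> concerns the underlying undirected graph; symmetry of
    the arcs turns it into directed reachability.\<close>
  have "strongly_connected (with_proj G)"
    using connected_graph pair_sym_arcs by (rule symmetric_connected_imp_strongly_connected[rotated])
  then have "q i \<rightarrow>\<^sup>*\<^bsub>with_proj G\<^esub> s"
    using agents[OF assms(1)] \<open>s \<in> pverts G\<close> by (auto simp: strongly_connected_def)
  then obtain r where "awalk (q i) r s"
    by (auto simp: reachable_awalk)
  then have "walk (Vertex (q i)) (subdivide_walk w r) (Vertex s)"
    by (rule walk_subdivide_walk)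
  moreover have "walk (Vertex s) (take x (subdivide_walk w P)) (path_point x)"
    using S.awalk_take_drop(1)[of "Vertex s" "subdivide_walk w P" "Vertex t" x] walk_path assms
    by (simp add: walk_def path_point_def length_subdivide_path)
  ultimately show ?thesis
    using walk_append by blast
qed

section \<open>Distances to points of the path\<close>

lemma d_le: "walk x p y \<Longrightarrow> d x y \<le> length p"
  unfolding walk_def d_def by (rule S.gdist_le)

lemma exists_shortest_walk_to_path_point:
  assumes "i < k" "x \<le> W"
  shows "\<exists>r. walk (Vertex (q i)) r (path_point x) \<and> length r = d (Vertex (q i)) (path_point x)"
  using exists_walk_to_path_point[OF assms] S.exists_shortest_awalk unfolding walk_def d_def by blast

text \<open>Extend the walk by the segment between the two points, traversed forwards or backwards;
  \<open>max x y - min x y\<close> is the absolute difference on naturals.\<close>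

lemma d_path_point_le:
  assumes "walk z p (path_point x)" "x \<le> W" "y \<le> W"
  shows "d z (path_point y) \<le> length p + (max x y - min x y)"
proof (cases "x \<le> y")
  case True
  then show ?thesis
    using d_le[OF walk_append[OF assms(1) walk_segment[of x y]]] assms by (simp add: length_segment)
next
  case False
  then obtain r where "walk (path_point x) r (path_point y)" "length r = x - y"
    using S.exists_reverse_awalk[of "path_point y" "segment y x" "path_point x"]
      walk_segment[of y x] length_segment[of y x] assms by (auto simp: walk_def)
  then show ?thesis
    using d_le[OF walk_append[OF assms(1)]] False by fastforce
qed

section \<open>Cutting the path into pieces\<close>

lemma admissible_pos: "admissible \<beta> \<Longrightarrow> 0 < \<beta>"
  using W_pos agents_pos by (cases "\<beta> = 0") (auto simp: admissible_def field_simps)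

text \<open>Everything follows from \<open>W = piece_length \<beta> 0 + m * \<beta>\<close> with a
  first piece that is positive and at most \<open>\<beta>\<close>.\<close>

lemma num_pieces_properties:
  assumes "0 < \<beta>"
  shows num_pieces_pos: "0 < num_pieces \<beta>"
    and piece_start_num_pieces: "piece_start \<beta> (num_pieces \<beta>) = W"
    and num_pieces_le: "W \<le> n * \<beta> \<Longrightarrow> num_pieces \<beta> \<le> n"
proof -
  \<comment> \<open>The number of pieces after the first. Subtracting 1 makes a multiple of
    \<open>\<beta>\<close> leave a first piece of length \<open>\<beta>\<close> instead of
    0.\<close>
  define m where "m = (W - 1) div \<beta>"
  have W_eq: "W = piece_length \<beta> 0 + m * \<beta>"
  proof (cases "W mod \<beta> = 0")
    case True
    then obtain c where "W = \<beta> * c"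
      by (auto simp: mod_eq_0_iff_dvd)
    moreover from this obtain c' where "c = Suc c'"
      using W_pos by (cases c) auto
    moreover have "(\<beta> + \<beta> * c' - 1) div \<beta> = c'"
      using assms by (intro div_nat_eqI) (auto simp: algebra_simps)
    ultimately show ?thesis
      by (simp add: piece_length_def m_def)
  next
    case False
    have W_div_mod: "W = \<beta> * (W div \<beta>) + W mod \<beta>"
      by simp
    have "(W - 1) div \<beta> = W div \<beta>"
    proof (rule div_nat_eqI)
      show "\<beta> * (W div \<beta>) \<le> W - 1"
        using W_div_mod False by linarith
      show "W - 1 < \<beta> * Suc (W div \<beta>)"
        unfolding mult_Suc_right using W_div_mod False mod_less_divisor[OF assms, of W] by linarith
    qed
    then show ?thesis
      using False by (simp add: piece_length_def m_def)
  qed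
  have first: "0 < piece_length \<beta> 0" "piece_length \<beta> 0 \<le> \<beta>"
    using assms mod_less_divisor[of \<beta> W] by (auto simp: piece_length_def)
  \<comment> \<open>The bounds on the first piece place the quotient strictly above \<open>m\<close>
    and at most at \<open>m + 1\<close>.\<close>
  have "\<lceil>real W / real \<beta>\<rceil> = int m + 1"
  proof (rule ceiling_unique)
    have "real W = real (piece_length \<beta> 0) + real m * real \<beta>"
      using W_eq by (metis of_nat_add of_nat_mult)
    then show "of_int (int m + 1) - 1 < real W / real \<beta>" "real W / real \<beta> \<le> of_int (int m + 1)"
      using first assms by (auto simp: field_simps)
  qed
  then have m: "num_pieces \<beta> = Suc m"
    by (simp add: num_pieces_def)
  then show "0 < num_pieces \<beta>"
    by simp
  have "piece_start \<beta> (Suc i) = piece_length \<beta> 0 + i * \<beta>" for i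
    by (induction i) (auto simp: piece_start_def piece_length_def)
  then show "piece_start \<beta> (num_pieces \<beta>) = W"
    using W_eq m by simp
  show "num_pieces \<beta> \<le> n" if "W \<le> n * \<beta>"
  proof -
    \<comment> \<open>Strict because the first piece is nonempty; hence
      \<open>m < n\<close>.\<close>
    have "m * \<beta> < n * \<beta>"
      using that W_eq first by linarith
    then show ?thesis
      using m by simp
  qed
qed

lemma piece_start_Suc: "piece_start \<beta> (Suc j) = piece_start \<beta> j + piece_length \<beta> j"
  by (simp add: piece_start_def)

lemma piece_start_le:
  assumes "0 < \<beta>" "j \<le> num_pieces \<beta>"
  shows "piece_start \<beta> j \<le> W"
  using mono_chain[of "num_pieces \<beta>" "piece_start \<beta>" j "num_pieces \<beta>"] assms
  by (simp add: piece_start_Suc piece_start_num_pieces)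

lemma piece_length_le: "0 < \<beta> \<Longrightarrow> piece_length \<beta> j \<le> \<beta>"
  using mod_less_divisor[of \<beta> W] by (auto simp: piece_length_def)

lemma admissible_iff: "admissible \<beta> \<longleftrightarrow> W \<le> k * \<beta> \<and> \<beta> \<le> W"
proof -
  have "real W / real k \<le> real \<beta> \<longleftrightarrow> real W \<le> real (k * \<beta>)"
    using agents_pos by (simp add: field_simps)
  then show ?thesis
    unfolding admissible_def of_nat_le_iff by simp
qed

section \<open>The algorithm\<close>

lemma cost_ge: "i < k \<Longrightarrow> length (p i) \<le> cost p"
  by (simp add: cost_def)

section \<open>Existence of an output\<close>

lemma covering_matching_id:
  assumes "admissible \<beta>"
  shows "covering_matching \<beta> id"
  \<comment> \<open>Admissibility bounds the number of pieces by \<open>k\<close>, so agent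
    \<open>j\<close> can take point \<open>j\<close>.\<close>
  using num_pieces_le[of \<beta> k] assms admissible_pos[OF assms]
  by (auto simp: covering_matching_def admissible_iff)

lemma exists_matching_solution:
  assumes "admissible \<beta>" "covering_matching \<beta> \<sigma>"
  shows "\<exists>p. matching_solution \<beta> \<sigma> p"
proof -
  have "\<exists>r. j < num_pieces \<beta> \<longrightarrow> walk (Vertex (q (\<sigma> j))) r (selection_point \<beta> j) \<and>
          length r = d (Vertex (q (\<sigma> j))) (selection_point \<beta> j)" for j
    using exists_shortest_walk_to_path_point[of "\<sigma> j" "piece_start \<beta> j"] assms
      piece_start_le[of \<beta> j] admissible_pos
    by (auto simp: covering_matching_def selection_point_def)
  then obtain r where r: "\<And>j. j < num_pieces \<beta> \<Longrightarrow>
      walk (Vertex (q (\<sigma> j))) (r j) (selection_point \<beta> j) \<and>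
      length (r j) = d (Vertex (q (\<sigma> j))) (selection_point \<beta> j)"
    by metis
  \<comment> \<open>Injectivity of \<open>\<sigma>\<close> allows looking up the piece of a matched
    agent; unmatched agents stay put.\<close>
  define p where "p i =
    (if i \<in> \<sigma> ` {..<num_pieces \<beta>}
     then let j = the_inv_into {..<num_pieces \<beta>} \<sigma> i
       in r j @ segment (piece_start \<beta> j) (piece_start \<beta> j + piece_length \<beta> j)
     else [])" for i
  have "matching_solution \<beta> \<sigma> p"
    using r assms(2)
    by (auto simp: matching_solution_def p_def covering_matching_def the_inv_into_f_f)
  then show ?thesis
    by blast
qed

text \<open>Objectives with natural values attain their minimum on any nonempty set:
  \<open>id\<close> is a covering matching, and \<open>W\<close> is an admissible parameter. The
  approximation guarantee is therefore not vacuous.\<close>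

lemma exists_matching_output: "\<exists>p. matching_output p"
proof -
  have "\<exists>\<sigma>. admissible \<gamma> \<longrightarrow> is_arg_min (bottleneck \<gamma>) (covering_matching \<gamma>) \<sigma>" for \<gamma>
    using is_arg_min_arg_min_nat[of "covering_matching \<gamma>" id "bottleneck \<gamma>"] covering_matching_id by blast
  then obtain M where
    M: "\<And>\<gamma>. admissible \<gamma> \<Longrightarrow> is_arg_min (bottleneck \<gamma>) (covering_matching \<gamma>) (M \<gamma>)"
    by metis
  have "admissible W"
    using agents_pos by (simp add: admissible_iff)
  then obtain \<beta> where \<beta>: "is_arg_min (\<lambda>\<gamma>. matching_value \<gamma> (M \<gamma>)) admissible \<beta>"
    using is_arg_min_arg_min_nat[of admissible W "\<lambda>\<gamma>. matching_value \<gamma> (M \<gamma>)"] by blast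
  then have "admissible \<beta>"
    by (simp add: is_arg_min_def)
  moreover from this have "covering_matching \<beta> (M \<beta>)"
    using M[of \<beta>] by (simp add: is_arg_min_def)
  ultimately obtain p where "matching_solution \<beta> (M \<beta>) p"
    using exists_matching_solution[of \<beta> "M \<beta>"] by auto
  with M \<beta> show ?thesis
    unfolding matching_output_def by blast
qed

section \<open>Feasibility and cost of the computed solution\<close>

lemma matching_solution_feasible:
  assumes "admissible \<beta>" "covering_matching \<beta> \<sigma>" "matching_solution \<beta> \<sigma> p"
  shows "feasible p"
proof -
  let ?m = "num_pieces \<beta>" and ?a = "piece_start \<beta>"
  note pos = admissible_pos[OF assms(1)]
  \<comment> \<open>The stages of the delivery are the pieces, carried by the agents
    \<open>\<sigma> j\<close>, each with an empty \<open>rest\<close>.\<close>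
  have stage: "\<exists>r. walk (Vertex (q (\<sigma> j))) r (path_point (?a j)) \<and>
      p (\<sigma> j) = r @ segment (?a j) (?a (Suc j))" if "j < ?m" for j
    using assms(3) that by (auto simp: matching_solution_def selection_point_def piece_start_Suc)
  have "\<exists>y. walk (Vertex (q i)) (p i) y" if "i < k" for i
  proof (cases "i \<in> \<sigma> ` {..<?m}")
    case True
    then obtain j where "j < ?m" "i = \<sigma> j"
      by auto
    then show ?thesis
      using stage[of j] walk_segment[of "?a j" "?a (Suc j)"] piece_start_le[OF pos, of "Suc j"]
        walk_append by (fastforce simp: piece_start_Suc)
  next
    case False
    then have "p i = []"
      using assms(3) that by (simp add: matching_solution_def)
    then show ?thesis
      using agents[OF that] walk_Nil[of "Vertex (q i)"] by (auto simp: subdivide_def)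
  qed
  moreover have "?a 0 = 0" "\<forall>j<?m. ?a j \<le> ?a (Suc j)"
    by (simp_all add: piece_start_def)
  moreover have "inj_on \<sigma> {..<?m}" "\<sigma> ` {..<?m} \<subseteq> {..<k}"
    using assms(2) by (auto simp: covering_matching_def)
  moreover have "\<forall>j<?m. \<exists>r rest. walk (Vertex (q (\<sigma> j))) r (path_point (?a j)) \<and>
      p (\<sigma> j) = r @ segment (?a j) (?a (Suc j)) @ rest"
    using stage by (metis append.right_neutral)
  ultimately show ?thesis
    unfolding feasible_def using piece_start_num_pieces[OF pos] by blast
qed

lemma matching_solution_cost_le:
  assumes "admissible \<beta>" "matching_solution \<beta> \<sigma> p"
  shows "cost p \<le> matching_value \<beta> \<sigma>"
proof -
  note pos = admissible_pos[OF assms(1)]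
  have "length (p i) \<le> matching_value \<beta> \<sigma>" if "i < k" for i
  proof (cases "i \<in> \<sigma> ` {..<num_pieces \<beta>}")
    case True
    then obtain j where j: "j < num_pieces \<beta>" "i = \<sigma> j"
      by auto
    then obtain r where "length r = d (Vertex (q (\<sigma> j))) (selection_point \<beta> j)"
      "p i = r @ segment (piece_start \<beta> j) (piece_start \<beta> j + piece_length \<beta> j)"
      using assms(2) unfolding matching_solution_def by blast
    then have "length (p i) = d (Vertex (q (\<sigma> j))) (selection_point \<beta> j) + piece_length \<beta> j"
      using piece_start_le[OF pos, of "Suc j"] j by (simp add: length_segment piece_start_Suc)
    then show ?thesis
      using j by (auto simp: matching_value_def intro!: Max_ge)
  next
    case False
    then show ?thesis
      using assms(2) that by (simp add: matching_solution_def)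
  qed
  then show ?thesis
    unfolding cost_def using agents_pos by (intro Max.boundedI) (auto simp: lessThan_empty_iff)
qed

section \<open>Comparison with an arbitrary feasible solution\<close>

lemma exists_good_matching:
  assumes "feasible p"
  shows "\<exists>\<beta> \<sigma>. admissible \<beta> \<and> \<beta> \<le> cost p \<and> covering_matching \<beta> \<sigma> \<and>
           bottleneck \<beta> \<sigma> \<le> cost p + \<beta>"
proof -
  obtain l a c where a: "a 0 = 0" "a l = W" "\<And>j. j < l \<Longrightarrow> a j \<le> a (Suc j)"
    and c: "inj_on c {..<l}" "c ` {..<l} \<subseteq> {..<k}"
    and stage: "\<forall>j<l. \<exists>approach rest. walk (Vertex (q (c j))) approach (path_point (a j)) \<and>
          p (c j) = approach @ segment (a j) (a (Suc j)) @ rest"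
    using assms by (auto simp: feasible_def)
  have a_le: "a j \<le> W" if "j \<le> l" for j
    using mono_chain[where a = a and l = l, OF a(3), of j l] a(2) that by simp
  have "\<exists>r. walk (Vertex (q (c j))) r (path_point (a j)) \<and>
      length r + (a (Suc j) - a j) \<le> cost p" if j: "j < l" for j
  proof -
    obtain r rest where "walk (Vertex (q (c j))) r (path_point (a j))"
      "p (c j) = r @ segment (a j) (a (Suc j)) @ rest"
      using stage j by blast
    moreover have "c j < k"
      using c(2) that by auto
    ultimately show ?thesis
      using cost_ge[of "c j" p] length_segment[of "a j" "a (Suc j)"] a(3)[OF that]
        a_le[of "Suc j"] that by auto
  qed
  then obtain r where r: "\<And>j. j < l \<Longrightarrow> walk (Vertex (q (c j))) (r j) (path_point (a j))"
    "\<And>j. j < l \<Longrightarrow> length (r j) + (a (Suc j) - a j) \<le> cost p"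
    by metis
  have "0 < l"
    using a W_pos by (cases l) auto
  \<comment> \<open>Different stages use different agents.\<close>
  have "l \<le> k"
    using card_inj_on_le[OF c] by simp
  \<comment> \<open>The longest stage. Summing the stages gives \<open>W \<le> l * \<beta>\<close>,
    which yields both admissibility and \<open>?m \<le> l\<close>.\<close>
  define \<beta> where "\<beta> = Max ((\<lambda>j. a (Suc j) - a j) ` {..<l})"
  have short: "a (Suc j) - a j \<le> \<beta>" if "j < l" for j
    using that by (auto simp: \<beta>_def intro!: Max_ge)
  have "\<beta> \<in> (\<lambda>j. a (Suc j) - a j) ` {..<l}"
    unfolding \<beta>_def using \<open>0 < l\<close> by (intro Max_in) auto
  then obtain j where "j < l" "\<beta> = a (Suc j) - a j"
    by auto
  then have "\<beta> \<le> cost p" "\<beta> \<le> W"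
    using r(2)[of j] a_le[of "Suc j"] by auto
  have "a j \<le> j * \<beta>" if "j \<le> l" for j
    using that
  proof (induction j)
    case (Suc j)
    then show ?case
      using short[of j] by simp
  qed (simp add: a)
  from this[of l] have "W \<le> l * \<beta>"
    using a(2) by simp
  also have "\<dots> \<le> k * \<beta>"
    using \<open>l \<le> k\<close> by simp
  finally have adm: "admissible \<beta>"
    using \<open>\<beta> \<le> W\<close> by (simp add: admissible_iff)
  note pos = admissible_pos[OF adm]
  let ?m = "num_pieces \<beta>" and ?x = "piece_start \<beta>"
  have "?m \<le> l"
    using num_pieces_le[OF pos \<open>W \<le> l * \<beta>\<close>] .
  have x_pos: "0 < ?x i" if "0 < i" for i
    using that pos by (cases i) (auto simp: piece_start_Suc piece_length_def)
  obtain f where f: "inj_on f {..<?m}" "f ` {..<?m} \<subseteq> {..<l}"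
    "\<And>i. i < ?m \<Longrightarrow> a (f i) \<le> ?x i \<and> ?x i \<le> a (Suc (f i)) \<or> ?x i \<le> a (f i) \<and> a (f i) \<le> ?x i + \<beta>"
    using injective_interval_assignment[where a = a and x = ?x and b = \<beta> and l = l and m = ?m]
      a short x_pos piece_start_le[OF pos] \<open>?m \<le> l\<close>
    by (auto simp: piece_start_def piece_length_def)
  have "covering_matching \<beta> (c \<circ> f)"
    unfolding covering_matching_def
    using f(1,2) c by (auto intro!: comp_inj_on intro: inj_on_subset)
  moreover have "bottleneck \<beta> (c \<circ> f) \<le> cost p + \<beta>"
  proof -
    have "d (Vertex (q (c (f i)))) (selection_point \<beta> i) \<le> cost p + \<beta>" if "i < ?m" for i
    proof -
      have fi: "f i < l"
        using f(2) that by auto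
      have "d (Vertex (q (c (f i)))) (selection_point \<beta> i)
          \<le> length (r (f i)) + (max (a (f i)) (?x i) - min (a (f i)) (?x i))"
        unfolding selection_point_def using fi that a_le piece_start_le[OF pos]
        by (intro d_path_point_le r(1)) auto
      \<comment> \<open>A point inside the stage of its agent is within the agent's original walk,
        at expense at most \<open>cost p\<close>; a point before that stage requires going back by
        at most \<open>\<beta>\<close>.\<close>
      also have "\<dots> \<le> cost p + \<beta>"
        using f(3)[OF that] r(2)[OF fi] by auto
      finally show ?thesis .
    qed
    then show ?thesis
      using num_pieces_pos[OF pos] by (auto simp: bottleneck_def intro!: Max.boundedI)
  qed
  ultimately show ?thesis
    using adm \<open>\<beta> \<le> cost p\<close> by blast
qed

text \<open>The bottleneck measures only the approach; carrying a piece adds at most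
  \<open>\<beta>\<close>, whichever agent is matched to it.\<close>

lemma matching_value_le:
  assumes "0 < \<beta>"
  shows "matching_value \<beta> \<sigma> \<le> bottleneck \<beta> \<sigma> + \<beta>"
proof -
  have "d (Vertex (q (\<sigma> j))) (selection_point \<beta> j) + piece_length \<beta> j \<le> bottleneck \<beta> \<sigma> + \<beta>"
    if "j < num_pieces \<beta>" for j
  proof (rule add_mono)
    show "d (Vertex (q (\<sigma> j))) (selection_point \<beta> j) \<le> bottleneck \<beta> \<sigma>"
      unfolding bottleneck_def using that by (intro Max_ge) auto
  qed (rule piece_length_le[OF assms])
  then show ?thesis
    unfolding matching_value_def using num_pieces_pos[OF assms] by (intro Max.boundedI) auto
qed

lemma matching_output_approximates:
  assumes "matching_output p"
  shows "feasible p \<and> cost p \<le> 3 * opt"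
proof -
  obtain M \<beta> where
    M: "\<And>\<gamma>. admissible \<gamma> \<Longrightarrow> is_arg_min (bottleneck \<gamma>) (covering_matching \<gamma>) (M \<gamma>)"
    and \<beta>: "is_arg_min (\<lambda>\<gamma>. matching_value \<gamma> (M \<gamma>)) admissible \<beta>"
    and p: "matching_solution \<beta> (M \<beta>) p"
    using assms by (auto simp: matching_output_def)
  have adm: "admissible \<beta>"
    using \<beta> by (simp add: is_arg_min_def)
  have "feasible p"
    using matching_solution_feasible[OF adm _ p] M[OF adm] by (simp add: is_arg_min_def)
  \<comment> \<open>The computed solution itself shows that the set minimized in \<open>opt\<close>
    is nonempty.\<close>
  then have "\<exists>p. feasible p \<and> cost p = opt"
    unfolding opt_def using LeastI_ex[of "\<lambda>r. \<exists>p. feasible p \<and> cost p = r"] by blast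
  then obtain p' where p': "feasible p'" "cost p' = opt"
    by blast
  \<comment> \<open>\<open>\<gamma>\<close> comes from an optimal solution, but the algorithm tries
    it too: minimality of \<open>\<beta>\<close> passes to \<open>M \<gamma>\<close>, and minimality
    of its bottleneck passes to \<open>\<sigma>\<close>.\<close>
  then obtain \<gamma> \<sigma> where \<gamma>: "admissible \<gamma>" "\<gamma> \<le> opt" "covering_matching \<gamma> \<sigma>"
    "bottleneck \<gamma> \<sigma> \<le> opt + \<gamma>"
    using exists_good_matching by metis
  have "cost p \<le> matching_value \<beta> (M \<beta>)"
    by (rule matching_solution_cost_le[OF adm p])
  also have "\<dots> \<le> matching_value \<gamma> (M \<gamma>)"
    using \<beta> \<gamma>(1) by (simp add: is_arg_min_linorder)
  also have "\<dots> \<le> bottleneck \<gamma> (M \<gamma>) + \<gamma>"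
    by (rule matching_value_le[OF admissible_pos[OF \<gamma>(1)]])
  also have "\<dots> \<le> bottleneck \<gamma> \<sigma> + \<gamma>"
    using M[OF \<gamma>(1)] \<gamma>(3) by (simp add: is_arg_min_linorder)
  also have "\<dots> \<le> 3 * opt"
    using \<gamma> by simp
  finally show ?thesis
    using \<open>feasible p\<close> by simp
qed

end

theorem theorem2:
  fixes G :: "'a pair_pre_digraph"
    and w :: "'a \<times> 'a \<Rightarrow> nat"
    and s t :: 'a
    and P :: "('a \<times> 'a) awalk"
    and k :: nat
    and q :: "nat \<Rightarrow> 'a"
  assumes "ripdd_instance G w s t P k q"
  shows "(\<exists>p. ripdd_instance.matching_output G w s P k q p) \<and>
         (\<forall>p. ripdd_instance.matching_output G w s P k q p \<longrightarrow>
              ripdd_instance.feasible G w s P k q p \<and>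
              ripdd_instance.cost k p \<le> 3 * ripdd_instance.opt G w s P k q)"
proof -
  interpret ripdd_instance G w s t P k q
    by (rule assms)
  show ?thesis
    using exists_matching_output matching_output_approximates by blast
qed

end
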